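(* Let $F$ be a field and let $h_1,h_2\in F[t]$ be irreducible polynomials with $\deg(h_1)\le\deg(h_2)$. Assume that either $\deg(h_1)$ does not divide $\deg(h_2)$, or $\deg(h_1)=\deg(h_2)$ and for at least one $i\in\{1,2\}$ the field $F[t]/(h_i)$ is not a splitting field of $h_i$ over $F$. Then for all $\phi,\psi\in F[z,w]$ the polynomial $f=h_1(z)\phi+h_2(w)\psi$ satisfies the implication $(\mathrm{KS}_F)$: if for every $\theta\in F[z,w]$ there exists $\theta'\in F[z,w]$ with $\theta-f\theta'\in F[z]+F[w]$, then either the total degree of $f$ is at most $2$, or $f$ is linear in $z$ or linear in $w$. In particular, let $a,b$ be square-free odd integers with $|a|,|b|>1$, and let $n$ be a positive integer that is not a power of $2$. Then for all $\phi,\psi\in\mathbb{Q}(i)[z,w]$ the polynomial $f=(z^n-a)\phi+(w^n-b)\psi$ satisfies the implication $(\mathrm{KS}_F)$ with $F=\mathbb{Q}(i)$.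
   Context: $F[z]+F[w]$ denotes the set of polynomials of the form $g_1(z)+g_2(w)$ in $F[z,w]$. "Linear in $z$" means of degree at most one as a polynomial in $z$ with coefficients in $F[w]$, and similarly for $w$. "$F[t]/(h_i)$ is not a splitting field over $F$" means that $h_i$ does not split into linear factors over the field $F[t]/(h_i)$. *)

theory Defs
  imports
    Complex_Main
    "HOL-Computational_Algebra.Computational_Algebra"
    "HOL-Algebra.Algebraic_Closure_Type"
begin

section \<open>Polynomials in two variables\<close>

text \<open>
  The ring \<open>F[z,w]\<close> is rendered as \<open>F[z][w]\<close>, i.e. as the type \<open>'a poly poly\<close>: the outer
  variable is \<open>w\<close>, the inner one \<open>z\<close>, so the coefficient of \<open>z^i * w^j\<close> in \<open>f\<close> is
  \<open>coeff (coeff f j) i\<close>.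
\<close>

definition in_z :: "'a::field poly \<Rightarrow> 'a poly poly" where
  "in_z g = [:g:]"

definition in_w :: "'a::field poly \<Rightarrow> 'a poly poly" where
  "in_w g = map_poly (\<lambda>c. [:c:]) g"

definition Fz_plus_Fw :: "'a::field poly poly set" where
  "Fz_plus_Fw = {in_z g1 + in_w g2 | g1 g2. True}"

text \<open>All degrees of the zero polynomial are \<open>0\<close>, as for \<^const>\<open>Polynomial.degree\<close>.\<close>

definition total_degree :: "'a::field poly poly \<Rightarrow> nat" where
  "total_degree f = Max (insert 0 {i + j | i j. poly.coeff (poly.coeff f j) i \<noteq> 0})"

definition degree_z :: "'a::field poly poly \<Rightarrow> nat" where
  "degree_z f = Max (insert 0 {i. \<exists>j. poly.coeff (poly.coeff f j) i \<noteq> 0})"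

definition degree_w :: "'a::field poly poly \<Rightarrow> nat" where
  "degree_w f = Polynomial.degree f"

definition KS_implication :: "'a::field poly poly \<Rightarrow> bool" where
  "KS_implication f \<longleftrightarrow>
     ((\<forall>\<theta>. \<exists>\<theta>'. \<theta> - f * \<theta>' \<in> Fz_plus_Fw) \<longrightarrow>
      total_degree f \<le> 2 \<or> degree_z f \<le> 1 \<or> degree_w f \<le> 1)"


section \<open>The field \<open>F[t]/(h)\<close>\<close>

definition residue_field :: "'a::field poly \<Rightarrow> 'a poly set ring" where
  "residue_field h = ring_of_type_algebra Quot (PIdl\<^bsub>ring_of_type_algebra\<^esub> h)"

definition residue_class :: "'a::field poly \<Rightarrow> 'a poly \<Rightarrow> 'a poly set" where
  "residue_class h p = (PIdl\<^bsub>ring_of_type_algebra\<^esub> h) +>\<^bsub>ring_of_type_algebra\<^esub> p"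

text \<open>
  Univariate polynomials over a record-based ring are coefficient lists with the leading
  coefficient first, whereas \<^const>\<open>coeffs\<close> starts with the constant coefficient.
  The list is normalised (nonzero head) because \<open>h\<close> is not a unit in all uses.
\<close>

definition poly_over_residue_field :: "'a::field poly \<Rightarrow> 'a poly \<Rightarrow> 'a poly set list" where
  "poly_over_residue_field h p = map (\<lambda>c. residue_class h [:c:]) (rev (coeffs p))"

definition residue_field_is_splitting_field :: "'a::field poly \<Rightarrow> bool" where
  "residue_field_is_splitting_field h \<longleftrightarrow>
     ring.splitted (residue_field h) (poly_over_residue_field h h)"


section \<open>The field \<open>\<rat>(\<i>)\<close>\<close>

typedef gauss_rat = "{z :: complex. Re z \<in> \<rat> \<and> Im z \<in> \<rat>}"
  by (intro exI[of _ 0]) simp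

setup_lifting type_definition_gauss_rat

instantiation gauss_rat :: field
begin

lift_definition zero_gauss_rat :: gauss_rat is 0
  by simp

lift_definition one_gauss_rat :: gauss_rat is 1
  by simp

lift_definition plus_gauss_rat :: "gauss_rat \<Rightarrow> gauss_rat \<Rightarrow> gauss_rat" is "(+)"
  by simp

lift_definition minus_gauss_rat :: "gauss_rat \<Rightarrow> gauss_rat \<Rightarrow> gauss_rat" is "(-)"
  by simp

lift_definition uminus_gauss_rat :: "gauss_rat \<Rightarrow> gauss_rat" is uminus
  by simp

lift_definition times_gauss_rat :: "gauss_rat \<Rightarrow> gauss_rat \<Rightarrow> gauss_rat" is "(*)"
  by simp

lift_definition inverse_gauss_rat :: "gauss_rat \<Rightarrow> gauss_rat" is inverse
  by simp

lift_definition divide_gauss_rat :: "gauss_rat \<Rightarrow> gauss_rat \<Rightarrow> gauss_rat" is "(/)"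
  by (simp add: Re_divide Im_divide)

instance
  by standard (transfer; simp add: algebra_simps divide_inverse)+

end

end

theory Submission
  imports Defs
begin

text \<open>
  If \<open>deg h1, deg h2 \<ge> 2\<close>, the implication holds because its premise fails already for
  \<open>\<theta> = z w\<close>: in \<open>F[t]/(h1) \<otimes> F[t]/(h2)\<close>, a quotient of \<open>F[z,w]/(f)\<close>, the
  element \<open>z w\<close> is not the sum of a polynomial in \<open>z\<close> and one in \<open>w\<close>. A linear functional
  witnessing this is \<open>l1 \<otimes> l2\<close>, where \<open>li\<close> takes the coefficient of \<open>t\<close> in the remainder
  modulo \<open>hi\<close>. Finally, \<open>deg h1 = 1\<close> is excluded by the hypotheses, since \<open>1\<close> divides \<open>deg h2\<close>
  and a linear polynomial splits.
\<close>

definition linear_residue :: "'a::field poly \<Rightarrow> 'a poly \<Rightarrow> 'a" where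
  "linear_residue h p = poly.coeff (p mod h) 1"

lemma linear_residue_0 [simp]: "linear_residue h 0 = 0"
  by (simp add: linear_residue_def)

lemma linear_residue_add: "linear_residue h (p + q) = linear_residue h p + linear_residue h q"
  by (simp add: linear_residue_def poly_mod_add_left)

lemma linear_residue_smult: "linear_residue h (smult c p) = c * linear_residue h p"
  by (simp add: linear_residue_def mod_smult_left)

lemma linear_residue_mult_self [simp]: "linear_residue h (h * p) = 0"
  by (simp add: linear_residue_def)

lemma linear_residue_const:
  assumes "Polynomial.degree h \<ge> 2"
  shows "linear_residue h [:c:] = 0"
  using assms by (simp add: linear_residue_def mod_poly_less)

lemma linear_residue_X:
  assumes "Polynomial.degree h \<ge> 2"
  shows "linear_residue h [:0, 1:] = 1"
  using assms by (simp add: linear_residue_def mod_poly_less)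

text \<open>This is \<open>l1\<close> \<otimes> \<open>l2\<close>. Because \<open>w\<close> is the
  outer variable, \<open>map_poly\<close> applies \<open>l1\<close> in the variable \<open>z\<close>
  and leaves a polynomial in \<open>w\<close> over the base field, to which \<open>l2\<close>
  applies.\<close>

definition residue_functional :: "'a::field poly \<Rightarrow> 'a poly \<Rightarrow> 'a poly poly \<Rightarrow> 'a" where
  "residue_functional h1 h2 f = linear_residue h2 (map_poly (linear_residue h1) f)"

text \<open>The map \<open>l1\<close> \<otimes> \<open>id\<close> to polynomials in \<open>w\<close>
  is linear over \<open>F[w]\<close>: the coefficients of \<open>in_w g\<close> are constants in
  \<open>z\<close>, and these pass through the \<open>F\<close>-linear \<open>l1\<close>. Hence
  multiples of \<open>h2(w)\<close> go to multiples of \<open>h2\<close>, which \<open>l2\<close>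
  kills.\<close>

lemma map_poly_linear_residue_in_w_mult:
  "map_poly (linear_residue h) (in_w g * f) = g * map_poly (linear_residue h) f"
proof (induction g)
  case 0
  then show ?case by (simp add: in_w_def)
next
  case (pCons c g)
  have "in_w (pCons c g) = pCons [:c:] (in_w g)"
    using pCons.hyps by (simp add: in_w_def map_poly_pCons)
  moreover have "map_poly (linear_residue h) (smult [:c:] f) = smult c (map_poly (linear_residue h) f)"
    by (intro poly_eqI) (simp add: coeff_map_poly linear_residue_smult)
  moreover have "map_poly (linear_residue h) (p + q)
      = map_poly (linear_residue h) p + map_poly (linear_residue h) q" for p q
    by (intro poly_eqI) (simp add: coeff_map_poly linear_residue_add)
  ultimately show ?case
    using pCons.IH by (simp add: map_poly_pCons)
qed

lemma residue_functional_add: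
  "residue_functional h1 h2 (f + g) = residue_functional h1 h2 f + residue_functional h1 h2 g"
proof -
  have "map_poly (linear_residue h1) (f + g)
      = map_poly (linear_residue h1) f + map_poly (linear_residue h1) g"
    by (intro poly_eqI) (simp add: coeff_map_poly linear_residue_add)
  then show ?thesis by (simp add: residue_functional_def linear_residue_add)
qed

lemma residue_functional_in_z_mult: "residue_functional h1 h2 (in_z h1 * f) = 0"
proof -
  have "map_poly (linear_residue h1) (in_z h1 * f) = 0"
    by (intro poly_eqI) (simp add: in_z_def coeff_map_poly)
  then show ?thesis by (simp add: residue_functional_def)
qed

lemma residue_functional_in_w_mult: "residue_functional h1 h2 (in_w h2 * f) = 0"
  by (simp add: residue_functional_def map_poly_linear_residue_in_w_mult)

text \<open>On a polynomial in \<open>z\<close> alone, \<open>l1\<close> leaves a constant in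
  \<open>w\<close>, which \<open>l2\<close> kills; a polynomial in \<open>w\<close> alone has
  constants in \<open>z\<close> as coefficients, which \<open>l1\<close> kills.\<close>

lemma residue_functional_Fz_plus_Fw:
  assumes "Polynomial.degree h1 \<ge> 2" "Polynomial.degree h2 \<ge> 2" "f \<in> Fz_plus_Fw"
  shows "residue_functional h1 h2 f = 0"
proof -
  from assms(3) obtain g1 g2 where f: "f = in_z g1 + in_w g2"
    by (auto simp: Fz_plus_Fw_def)
  have "map_poly (linear_residue h1) (in_z g1) = [:linear_residue h1 g1:]"
    by (simp add: in_z_def map_poly_pCons)
  then have "residue_functional h1 h2 (in_z g1) = 0"
    using assms(2) by (simp add: residue_functional_def linear_residue_const)
  moreover have "map_poly (linear_residue h1) (in_w g2) = 0"
    using assms(1) by (intro poly_eqI) (simp add: in_w_def coeff_map_poly linear_residue_const)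
  ultimately show ?thesis
    by (simp add: f residue_functional_add residue_functional_def[of h1 h2 "in_w g2"])
qed

lemma residue_functional_zw:
  assumes "Polynomial.degree h1 \<ge> 2" "Polynomial.degree h2 \<ge> 2"
  shows "residue_functional h1 h2 [:0, [:0, 1:]:] = 1"
  using assms by (simp add: residue_functional_def map_poly_pCons linear_residue_X)

lemma KS_implication_if_degrees_ge_2:
  assumes "Polynomial.degree h1 \<ge> 2" "Polynomial.degree h2 \<ge> 2"
  shows "KS_implication (in_z h1 * \<phi> + in_w h2 * \<psi>)"
proof -
  let ?f = "in_z h1 * \<phi> + in_w h2 * \<psi>" and ?zw = "[:0, [:0, 1:]:] :: 'a poly poly"
  have "?zw - ?f * \<theta>' \<notin> Fz_plus_Fw" for \<theta>'
  proof
    assume "?zw - ?f * \<theta>' \<in> Fz_plus_Fw"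
    then have "residue_functional h1 h2 (?zw - ?f * \<theta>') = 0"
      by (rule residue_functional_Fz_plus_Fw[OF assms])
    \<comment> \<open>The second summand is \<open>?f * \<theta>'\<close>, written as an element of
      the ideal generated by \<open>h1(z)\<close> and \<open>h2(w)\<close>, on which the functional
      vanishes.\<close>
    moreover have "?zw = (?zw - ?f * \<theta>') + (in_z h1 * (\<phi> * \<theta>') + in_w h2 * (\<psi> * \<theta>'))"
      by (simp add: algebra_simps)
    ultimately have "residue_functional h1 h2 ?zw = 0"
      by (metis residue_functional_add residue_functional_in_z_mult residue_functional_in_w_mult
          add_0)
    then show False
      using residue_functional_zw[OF assms] by simp
  qed
  then show ?thesis
    unfolding KS_implication_def by blast
qed

lemma cgenideal_ring_of_type_algebra:
  "PIdl\<^bsub>ring_of_type_algebra\<^esub> h = {p :: 'a::field poly. h dvd p}"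
  by (auto simp: cgenideal_def ring_of_type_algebra_def dvd_def mult.commute)

text \<open>Makes the quotient a field, so that facts about splitting over fields apply to it. An
  ideal strictly above \<open>(h)\<close> contains a nonzero constant, namely a remainder modulo
  \<open>h\<close>, and is therefore everything.\<close>

lemma maximalideal_linear_poly:
  fixes h :: "'a::field poly"
  assumes "Polynomial.degree h = 1"
  shows "maximalideal (PIdl\<^bsub>ring_of_type_algebra\<^esub> h) ring_of_type_algebra"
proof -
  let ?R = "ring_of_type_algebra :: 'a poly ring"
  interpret R: cring ?R by (rule cring_from_type_algebra)
  have carrier: "carrier ?R = UNIV" and mult: "x \<otimes>\<^bsub>?R\<^esub> y = x * y"
    and add: "x \<oplus>\<^bsub>?R\<^esub> y = x + y" and one: "\<one>\<^bsub>?R\<^esub> = 1" for x y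
    by (simp_all add: ring_of_type_algebra_def)
  have "h \<noteq> 0" using assms by auto
  have not_dvd: "\<not> h dvd 1"
    using assms by (metis One_nat_def degree_1 dvd_imp_degree_le not_one_le_zero one_neq_zero)
  show ?thesis
  proof (rule maximalidealI)
    show "ideal (PIdl\<^bsub>?R\<^esub> h) ?R"
      by (rule R.cgenideal_ideal) (simp add: carrier)
    show "carrier ?R \<noteq> PIdl\<^bsub>?R\<^esub> h"
      using not_dvd by (auto simp: carrier cgenideal_ring_of_type_algebra)
    fix J assume J: "ideal J ?R" "PIdl\<^bsub>?R\<^esub> h \<subseteq> J"
    interpret J: ideal J ?R by (rule J(1))
    have "J = carrier ?R" if "x \<in> J" "\<not> h dvd x" for x
    proof -
      have "x mod h \<noteq> 0" using that(2) by (simp add: mod_eq_0_iff_dvd)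
      moreover have "Polynomial.degree (x mod h) = 0"
        using degree_mod_less[OF \<open>h \<noteq> 0\<close>, of x] assms by auto
      ultimately obtain c where c: "x mod h = [:c:]" "c \<noteq> 0"
        by (metis degree_eq_zeroE pCons_0_0)
      \<comment> \<open>Subtracting this multiple of \<open>h\<close> from \<open>x\<close> puts the
        remainder \<open>[:c:]\<close> in \<open>J\<close>; multiplying by
        \<open>[:inverse c:]\<close> then gives 1.\<close>
      have "h * (- (x div h)) \<in> J"
        using J(2) by (auto simp: cgenideal_ring_of_type_algebra)
      then have "x + h * (- (x div h)) \<in> J"
        using J.a_closed[OF that(1)] by (simp only: add)
      moreover have "x + h * (- (x div h)) = [:c:]"
        using c(1) by (simp add: minus_mult_div_eq_mod)
      ultimately have "[:c:] * [:inverse c:] \<in> J"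
        using J.I_r_closed[of "[:c:]" "[:inverse c:]"] by (simp only: mult carrier UNIV_I)
      then have "\<one>\<^bsub>?R\<^esub> \<in> J"
        using c(2) by (simp add: one one_pCons)
      then show ?thesis by (rule J.one_imp_carrier)
    qed
    then show "J = PIdl\<^bsub>?R\<^esub> h \<or> J = carrier ?R"
      using J(2) by (auto simp: cgenideal_ring_of_type_algebra)
  qed
qed

text \<open>Polynomials of degree one split over any field. What remains is that the coefficient
  list is a genuine polynomial over the quotient.\<close>

lemma residue_field_is_splitting_field_linear:
  fixes h :: "'a::field poly"
  assumes "Polynomial.degree h = 1"
  shows "residue_field_is_splitting_field h"
proof -
  let ?R = "ring_of_type_algebra :: 'a poly ring"
  let ?I = "PIdl\<^bsub>?R\<^esub> h"
  interpret R: cring ?R by (rule cring_from_type_algebra)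
  interpret I: maximalideal ?I ?R by (rule maximalideal_linear_poly[OF assms])
  interpret K: field "residue_field h"
    unfolding residue_field_def by (rule I.quotient_is_field[OF R.is_cring])
  have carrier: "carrier ?R = UNIV"
    by (simp add: ring_of_type_algebra_def)
  obtain a b where h: "h = [:a, b:]" "b \<noteq> 0"
    using degree1_coeffs[OF assms] .
  have p: "poly_over_residue_field h h = [residue_class h [:b:], residue_class h [:a:]]"
    using h by (simp add: poly_over_residue_field_def cCons_def)
  have residue_class_closed: "residue_class h q \<in> carrier (residue_field h)" for q
    unfolding residue_class_def residue_field_def
    using ring_hom_closed[OF I.rcos_ring_hom, of q] by (simp add: carrier)
  \<comment> \<open>The head of the list must be nonzero for it to be normalised. Otherwise
    \<open>h\<close>, of degree 1, would divide the nonzero constant \<open>b\<close>.\<close>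
  have "residue_class h [:b:] \<noteq> \<zero>\<^bsub>residue_field h\<^esub>"
  proof
    assume "residue_class h [:b:] = \<zero>\<^bsub>residue_field h\<^esub>"
    then have "?I +>\<^bsub>?R\<^esub> [:b:] = ?I"
      by (simp add: residue_class_def residue_field_def FactRing_def)
    then have "[:b:] \<in> ?I"
      using I.a_rcos_self[of "[:b:]"] by (simp add: carrier)
    then have "h dvd [:b:]"
      by (simp add: cgenideal_ring_of_type_algebra)
    then show False
      using h(2) assms by (auto dest: dvd_imp_degree_le)
  qed
  then have "poly_over_residue_field h h \<in> carrier (poly_ring (residue_field h))"
    using residue_class_closed by (simp add: p polynomial_def flip: univ_poly_carrier)
  then show ?thesis
    unfolding residue_field_is_splitting_field_def
    by (rule K.degree_one_imp_splitted) (simp add: p)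
qed

lemma degree_X_power_minus_const:
  assumes "n > 0"
  shows "Polynomial.degree ([:0, 1:] ^ n - [:c :: 'a::field:]) = n"
proof -
  have "Polynomial.degree ([:0, 1 :: 'a:] ^ n) = n"
    by (simp add: degree_power_eq)
  then show ?thesis
    using assms degree_add_eq_left[of "- [:c:]" "[:0, 1 :: 'a:] ^ n"]
    by (simp del: minus_pCons)
qed

theorem theorem1p2:
  shows "(\<forall>(h1 :: 'a::field poly) (h2 :: 'a poly).
            Factorial_Ring.irreducible h1 \<longrightarrow>
            Factorial_Ring.irreducible h2 \<longrightarrow>
            Polynomial.degree h1 \<le> Polynomial.degree h2 \<longrightarrow>
            (\<not> Polynomial.degree h1 dvd Polynomial.degree h2 \<or>
             Polynomial.degree h1 = Polynomial.degree h2 \<and>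
             (\<not> residue_field_is_splitting_field h1 \<or> \<not> residue_field_is_splitting_field h2)) \<longrightarrow>
            (\<forall>\<phi> \<psi> :: 'a poly poly. KS_implication (in_z h1 * \<phi> + in_w h2 * \<psi>)))
       \<and> (\<forall>(a :: int) (b :: int) (n :: nat).
            squarefree a \<longrightarrow> odd a \<longrightarrow> \<bar>a\<bar> > 1 \<longrightarrow>
            squarefree b \<longrightarrow> odd b \<longrightarrow> \<bar>b\<bar> > 1 \<longrightarrow>
            n > 0 \<longrightarrow> (\<forall>k. n \<noteq> 2 ^ k) \<longrightarrow>
            (\<forall>\<phi> \<psi> :: gauss_rat poly poly.
               KS_implication (in_z ([:0, 1:] ^ n - [:of_int a:]) * \<phi>
                             + in_w ([:0, 1:] ^ n - [:of_int b:]) * \<psi>)))"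
proof (intro conjI allI impI)
  fix h1 h2 :: "'a poly" and \<phi> \<psi> :: "'a poly poly"
  assume irred: "Factorial_Ring.irreducible h1"
    and le: "Polynomial.degree h1 \<le> Polynomial.degree h2"
    and deg: "\<not> Polynomial.degree h1 dvd Polynomial.degree h2 \<or>
             Polynomial.degree h1 = Polynomial.degree h2 \<and>
             (\<not> residue_field_is_splitting_field h1 \<or> \<not> residue_field_is_splitting_field h2)"
  have "Polynomial.degree h1 \<noteq> 0"
    using irred by (auto simp: irreducible_def is_unit_iff_degree)
  \<comment> \<open>Since 1 divides every degree, only the second alternative of \<open>deg\<close>
    could hold; then both polynomials are linear, so both residue fields are splitting fields, a
    contradiction.\<close>
  moreover have "Polynomial.degree h1 \<noteq> 1"
    using deg residue_field_is_splitting_field_linear by (metis one_dvd)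
  ultimately show "KS_implication (in_z h1 * \<phi> + in_w h2 * \<psi>)"
    using le by (intro KS_implication_if_degrees_ge_2) auto
next
  fix a b :: int and n :: nat and \<phi> \<psi> :: "gauss_rat poly poly"
  assume "n > 0" and "\<forall>k. n \<noteq> 2 ^ k"
  \<comment> \<open>The instance \<open>k = 0\<close> excludes \<open>n = 1\<close>. Both binomials
    have degree \<open>n\<close>, so the criterion on degrees applies.\<close>
  then have "n \<ge> 2"
    by (metis One_nat_def Suc_leI le_neq_implies_less numeral_2_eq_2 power_0)
  then show "KS_implication (in_z ([:0, 1:] ^ n - [:of_int a:]) * \<phi>
                             + in_w ([:0, 1:] ^ n - [:of_int b:]) * \<psi>)"
    by (intro KS_implication_if_degrees_ge_2) (simp_all add: degree_X_power_minus_const)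
qed

end
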